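(* Let $a,b\in[\tfrac12,1]$ and $\gamma:=2-\sqrt3$. The SDP relaxation with McCormick cuts of the instance $(Q(a,b),c(a,b))$ has an optimal solution $(x^*(a),X^*(a))$, independent of $b$, given by $$x^*(a)=\begin{pmatrix}\frac{\gamma}{3a}\\ \frac13\\ \frac23\\ 1-\frac{2\gamma}{3}\end{pmatrix},\qquad X^*(a)=\begin{pmatrix}\frac{\gamma}{6a^2}&\frac{\gamma}{3a}&\frac{\gamma}{3a}&\frac{1-3\gamma}{3a}\\ \frac{\gamma}{3a}&\frac{1-\gamma}{3}&\frac13&\frac13\\ \frac{\gamma}{3a}&\frac13&\frac{2-\gamma}{3}&\frac23\\ \frac{1-3\gamma}{3a}&\frac13&\frac23&1-\frac{2\gamma}{3}\end{pmatrix}.$$ For all $a,b\in[\tfrac12,1]$, the optimal value of this SDP relaxation is $\sqrt3-\tfrac74<0$.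
   Context: For real $a,b$, $$Q(a,b)=\begin{pmatrix} a^2 & -a & 0 & 0 \\ -a & 1 & -1 & 0 \\ 0 & -1 & 1 & -b \\ 0 & 0 & -b & \frac14 \end{pmatrix},\qquad c(a,b)=\begin{pmatrix} a \\ 1 \\ 2b-1 \\ 0 \end{pmatrix}.$$ $\mathbb{S}^4$ is the space of real symmetric $4\times4$ matrices and $Q\bullet X=\sum_{i,j}Q_{ij}X_{ij}$. The SDP relaxation with McCormick cuts of an instance $(Q,c)$ in dimension $4$ is the problem of minimizing $Q\bullet X+c^\top x$ over $(x,X)\in\mathbb{R}^4\times\mathbb{S}^4$ subject to $\begin{pmatrix} 1 & x^\top \\ x & X \end{pmatrix}\succeq0$ and the McCormick inequalities: for all $i\ne j$, $$X_{ij}\ge0,\quad X_{ij}\ge x_i+x_j-1,\quad X_{ij}\le x_i,\quad X_{ij}\le x_j.$$ *)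

theory Defs
  imports "HOL-Analysis.Analysis"
begin

definition psd :: "real^'n^'n \<Rightarrow> bool" where
  "psd M \<longleftrightarrow> transpose M = M \<and> (\<forall>v. 0 \<le> v \<bullet> (M *v v))"

definition frob :: "real^'n^'n \<Rightarrow> real^'n^'n \<Rightarrow> real" where
  "frob Q X = (\<Sum>i\<in>UNIV. \<Sum>j\<in>UNIV. Q $ i $ j * X $ i $ j)"

text \<open>The bordered matrix with rows \<open>(1, x\<^sup>T)\<close> and \<open>(x, X)\<close>, of order one more than \<open>X\<close>.
  The extra row and column have index \<open>None\<close>.\<close>

definition bordered :: "real^'n \<Rightarrow> real^'n^'n \<Rightarrow> real^('n option)^('n option)" where
  "bordered x X = (\<chi> i j. case i of
       None \<Rightarrow> (case j of None \<Rightarrow> 1 | Some l \<Rightarrow> x $ l)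
     | Some k \<Rightarrow> (case j of None \<Rightarrow> x $ k | Some l \<Rightarrow> X $ k $ l))"

definition mccormick :: "real^'n \<Rightarrow> real^'n^'n \<Rightarrow> bool" where
  "mccormick x X \<longleftrightarrow> (\<forall>i j. i \<noteq> j \<longrightarrow>
     X $ i $ j \<ge> 0 \<and> X $ i $ j \<ge> x $ i + x $ j - 1 \<and>
     X $ i $ j \<le> x $ i \<and> X $ i $ j \<le> x $ j)"

definition sdp_feasible :: "((real^'n) \<times> (real^'n^'n)) set" where
  "sdp_feasible = {(x, X). transpose X = X \<and> psd (bordered x X) \<and> mccormick x X}"

definition sdp_objective ::
    "real^'n^'n \<Rightarrow> real^'n \<Rightarrow> (real^'n) \<times> (real^'n^'n) \<Rightarrow> real" where
  "sdp_objective Q c = (\<lambda>(x, X). frob Q X + c \<bullet> x)"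

definition sdp_optimal ::
    "real^'n^'n \<Rightarrow> real^'n \<Rightarrow> (real^'n) \<times> (real^'n^'n) \<Rightarrow> bool" where
  "sdp_optimal Q c p \<longleftrightarrow> p \<in> sdp_feasible \<and>
     (\<forall>q\<in>sdp_feasible. sdp_objective Q c p \<le> sdp_objective Q c q)"

text \<open>The value is taken in the extended reals, so that an unbounded problem would have
  value \<open>-\<infinity>\<close>.\<close>

definition sdp_value :: "real^'n^'n \<Rightarrow> real^'n \<Rightarrow> ereal" where
  "sdp_value Q c = (INF p\<in>sdp_feasible. ereal (sdp_objective Q c p))"

definition Q_inst :: "real \<Rightarrow> real \<Rightarrow> real^4^4" where
  "Q_inst a b = vector [
     vector [a^2, -a,  0,  0],
     vector [-a,   1, -1,  0],
     vector [ 0,  -1,  1, -b],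
     vector [ 0,   0, -b, 1/4]]"

definition c_inst :: "real \<Rightarrow> real \<Rightarrow> real^4" where
  "c_inst a b = vector [a, 1, 2 * b - 1, 0]"

definition gam :: real where
  "gam = 2 - sqrt 3"

definition x_star :: "real \<Rightarrow> real^4" where
  "x_star a = vector [gam / (3 * a), 1/3, 2/3, 1 - 2 * gam / 3]"

definition X_star :: "real \<Rightarrow> real^4^4" where
  "X_star a = vector [
     vector [gam / (6 * a^2),         gam / (3 * a), gam / (3 * a), (1 - 3 * gam) / (3 * a)],
     vector [gam / (3 * a),           (1 - gam) / 3, 1/3,           1/3],
     vector [gam / (3 * a),           1/3,           (2 - gam) / 3, 2/3],
     vector [(1 - 3 * gam) / (3 * a), 1/3,           2/3,           1 - 2 * gam / 3]]"

lemma vector_4 [simp]: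
  "(vector [x, y, z, w] :: 'a::zero^4) $ 1 = x"
  "(vector [x, y, z, w] :: 'a::zero^4) $ 2 = y"
  "(vector [x, y, z, w] :: 'a::zero^4) $ 3 = z"
  "(vector [x, y, z, w] :: 'a::zero^4) $ 4 = w"
  unfolding vector_def by simp_all

end

theory Submission
  imports Defs
begin

text \<open>Write \<open>\<gamma> = 2 - \<surd>3\<close>, which satisfies \<open>\<gamma>\<^sup>2 = 4\<gamma> - 1\<close>; all identities below are polynomial
  identities modulo this relation. The proof is a pair of matching certificates.

  Feasibility. After the first coordinate is rescaled by \<open>a\<close>, the bordered matrix of the claimed
  solution is the moment matrix of a probability distribution on three points,
    \<open>(\<gamma>/2, 0, 0, 0)\<close>, \<open>(\<gamma>, 1-\<gamma>, 1, 1)\<close>, \<open>((2\<gamma>-1)/3, 0, (2-\<gamma>)/3, 1)\<close>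
  with weights \<open>2\<gamma>/3\<close>, \<open>(3-\<gamma>)/6\<close>, \<open>(1-\<gamma>)/2\<close>. Hence its quadratic form is a sum of three squares
  (\<open>psd_bordered_star\<close>).

  Optimality. For every \<open>(x, X)\<close> with \<open>X\<close> symmetric the objective minus \<open>1/4 - \<gamma>\<close> equals a quarter of
  \<open>\<langle>uu\<^sup>T + vv\<^sup>T, Y\<rangle>\<close>, where \<open>Y\<close> is the bordered matrix and
    \<open>u = (0, 0, 1, -\<surd>3, 1)\<close>, \<open>v = (\<gamma>, -2a, \<surd>3, -1, 0)\<close>,
  plus a combination with nonnegative multipliers of the slacks \<open>x\<^sub>1 - X\<^sub>1\<^sub>2\<close>, \<open>x\<^sub>1 - X\<^sub>1\<^sub>3\<close>,
  \<open>x\<^sub>2 - X\<^sub>2\<^sub>3\<close>, \<open>x\<^sub>2 - X\<^sub>2\<^sub>4\<close> and \<open>x\<^sub>3 - X\<^sub>3\<^sub>4\<close> (\<open>objective_lower_bound\<close>).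
  The certificates fit together by complementary slackness: \<open>u\<close> and \<open>v\<close> are orthogonal to
  \<open>(1, y\<^sub>1/a, y\<^sub>2, y\<^sub>3, y\<^sub>4)\<close> for each of the three points \<open>y\<close>, and the five slacks vanish at the
  solution. The parameter \<open>b\<close> enters the objective only
  through \<open>2b (x\<^sub>3 - X\<^sub>3\<^sub>4)\<close>, a multiple of a slack that is zero there; this is why the solution does
  not depend on \<open>b\<close>.\<close>

lemma sdp_value_eq_objective_of_optimal:
  assumes "sdp_optimal Q c p"
  shows "sdp_value Q c = ereal (sdp_objective Q c p)"
  using assms unfolding sdp_value_def sdp_optimal_def
  by (intro antisym INF_lower INF_greatest) auto

lemma quadratic_form_bordered:
  fixes x :: "real^'n" and v :: "real^('n option)"
  shows "v \<bullet> (bordered x X *v v) =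
    (v $ None)^2 + v $ None * (\<Sum>k\<in>UNIV. x $ k * v $ Some k)
      + (\<Sum>k\<in>UNIV. v $ Some k * (v $ None * x $ k + (\<Sum>l\<in>UNIV. X $ k $ l * v $ Some l)))"
proof -
  have split: "(\<Sum>i\<in>UNIV. f i) = f None + (\<Sum>k\<in>UNIV. f (Some k))" for f :: "'n option \<Rightarrow> real"
    by (simp add: UNIV_option_conv sum.reindex)
  show ?thesis
    unfolding inner_vec_def matrix_vector_mult_def
    by (simp add: split bordered_def algebra_simps power2_eq_square sum_distrib_left)
qed

lemma transpose_bordered:
  assumes "transpose X = X"
  shows "transpose (bordered x X) = bordered x X"
proof -
  have "X $ i $ j = X $ j $ i" for i j
    using assms by (metis (no_types) transpose_def vec_lambda_beta)
  then show ?thesis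
    by (auto simp: vec_eq_iff transpose_def bordered_def split: option.splits)
qed

lemma gam_squared: "gam^2 = 4 * gam - 1"
  by (simp add: gam_def power2_eq_square algebra_simps)

text \<open>Oriented as rewrite rules, the quadratic relation reduces every polynomial in \<open>gam\<close> to a
  linear one. The second rule catches products that are nested to the right.\<close>

lemma gam_mult_reduce:
  "gam * gam = 4 * gam - 1" "gam * (gam * z) = 4 * (gam * z) - z"
proof -
  show sq: "gam * gam = 4 * gam - 1"
    using gam_squared by (simp only: power2_eq_square)
  have "gam * (gam * z) = (gam * gam) * z"
    by (simp only: mult.assoc)
  also have "\<dots> = 4 * (gam * z) - z"
    unfolding sq by (simp add: left_diff_distrib)
  finally show "gam * (gam * z) = 4 * (gam * z) - z" .
qed

lemma gam_bounds: "4/15 < gam" "gam < 3/11"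
proof -
  have "sqrt 3 < 26/15" by (rule real_less_lsqrt) (auto simp: power2_eq_square)
  moreover have "19/11 < sqrt 3" by (rule real_less_rsqrt) (auto simp: power2_eq_square)
  ultimately show "4/15 < gam" "gam < 3/11" by (auto simp: gam_def)
qed

text \<open>The dual certificate. If only the five slacks below get a multiplier, the
  multipliers are forced: the dual slack matrix must annihilate the bordered matrix of the solution,
  and this linear system has a unique solution. The slack of the pair \<open>(3, 4)\<close> gets
  \<open>2 b - 1 + gam / 2\<close>, which is nonnegative because \<open>b \<ge> 1/2\<close>.\<close>

lemma objective_lower_bound:
  assumes "a > 0" and b: "b \<ge> 1/2" and feas: "(x, X) \<in> sdp_feasible"
  shows "sdp_objective (Q_inst a b) (c_inst a b) (x, X) \<ge> 1/4 - gam"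
proof -
  have tr: "transpose X = X" and psd: "psd (bordered x X)" and mc: "mccormick x X"
    using feas by (auto simp: sdp_feasible_def)
  have sym: "X $ i $ j = X $ j $ i" for i j
    using tr by (metis (no_types) transpose_def vec_lambda_beta)
  \<comment> \<open>The quadratic form of the bordered matrix at the vector \<open>(t, s)\<close>.\<close>
  define q where "q t s = (let v = (\<chi> i. case i of None \<Rightarrow> t | Some k \<Rightarrow> s $ k) in
      v \<bullet> (bordered x X *v v))" for t and s :: "real^4"
  have q_nonneg: "q t s \<ge> 0" for t s
    using psd by (simp add: q_def psd_def Let_def)
  \<comment> \<open>The vectors \<open>u\<close> and \<open>v\<close>, with \<open>\<surd>3\<close> written as \<open>2 - gam\<close>.\<close>
  let ?u = "q 0 (vector [0, 1, gam - 2, 1])"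
  let ?v = "q gam (vector [- 2 * a, 2 - gam, - 1, 0])"
  have "sdp_objective (Q_inst a b) (c_inst a b) (x, X) + gam - 1/4 = ?u / 4 + ?v / 4
     + a * gam * (x $ 1 - X $ 1 $ 2) + a * (x $ 1 - X $ 1 $ 3)
     + gam * (x $ 2 - X $ 2 $ 3) + (x $ 2 - X $ 2 $ 4) / 2
     + (2 * b - 1 + gam / 2) * (x $ 3 - X $ 3 $ 4)"
    unfolding q_def Let_def quadratic_form_bordered sdp_objective_def frob_def Q_inst_def c_inst_def
    apply (simp add: sum_4 inner_vec_def sym[of 2 1] sym[of 3 1] sym[of 4 1] sym[of 3 2] sym[of 4 2]
      sym[of 4 3])
    apply (simp add: field_simps power2_eq_square gam_mult_reduce)
    done
  moreover have "X $ i $ j \<le> x $ i" if "i \<noteq> j" for i j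
    using mc that by (auto simp: mccormick_def)
  then have "a * gam * (x $ 1 - X $ 1 $ 2) \<ge> 0" "a * (x $ 1 - X $ 1 $ 3) \<ge> 0"
     "gam * (x $ 2 - X $ 2 $ 3) \<ge> 0" "(x $ 2 - X $ 2 $ 4) / 2 \<ge> 0"
     "(2 * b - 1 + gam / 2) * (x $ 3 - X $ 3 $ 4) \<ge> 0"
    using gam_bounds \<open>a > 0\<close> b by simp_all
  ultimately show ?thesis
    using q_nonneg[of 0 "vector [0, 1, gam - 2, 1]"] q_nonneg[of gam "vector [- 2 * a, 2 - gam, - 1, 0]"]
    by linarith
qed

lemma mccormick_star:
  assumes a: "a \<in> {1/2..1}"
  shows "mccormick (x_star a) (X_star a)"
proof -
  \<comment> \<open>In the variables \<open>1 / a\<close> and \<open>gam / a\<close> all the inequalities become linear.\<close>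
  define k where "k = 1 / a"
  define P where "P = gam * k"
  have k: "1 \<le> k" "k \<le> 2"
    using a by (auto simp: k_def field_simps)
  have "4/15 * k \<le> gam * k" "gam * k \<le> 3/11 * k" "gam * k \<le> gam * 2"
    using gam_bounds k by (intro mult_right_mono mult_left_mono; simp)+
  then have P: "4/15 * k \<le> P" "P \<le> 3/11 * k" "P \<le> gam * 2"
    by (auto simp: P_def)
  have entries: "gam / (3 * a) = P / 3" "(1 - 3 * gam) / (3 * a) = k / 3 - P"
    using a by (auto simp: P_def k_def field_simps)
  show ?thesis
    unfolding mccormick_def forall_4 x_star_def X_star_def vector_4 entries
    using P k gam_bounds by (intro conjI impI) simp_all
qed

lemma objective_star:
  assumes "a > 0"
  shows "sdp_objective (Q_inst a b) (c_inst a b) (x_star a, X_star a) = 1/4 - gam"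
  using assms unfolding sdp_objective_def frob_def Q_inst_def c_inst_def x_star_def X_star_def
  by (simp add: sum_4 inner_vec_def field_simps power2_eq_square)

lemma transpose_X_star: "transpose (X_star a) = X_star a"
  by (simp add: vec_eq_iff forall_4 transpose_def X_star_def)

text \<open>The moment representation by three points, multiplied by \<open>18\<close> so that it is an identity with
  integer coefficients. The left side is \<open>18\<close> times the quadratic form of the claimed solution at
  \<open>(t, a w, p, q, r)\<close>; the three squares on the right come from the points, with their weights and
  denominators absorbed.\<close>

lemma three_points_identity:
  fixes t w p q r g :: real
  assumes "g^2 = 4 * g - 1"
  shows "18 * t^2 + 12 * t * (g * w + p + 2 * q + (3 - 2 * g) * r)
      + 3 * g * w^2 + 12 * g * w * p + 12 * g * w * q + 12 * (1 - 3 * g) * w * r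
      + 6 * (1 - g) * p^2 + 12 * p * q + 12 * p * r
      + 6 * (2 - g) * q^2 + 24 * q * r + 6 * (3 - 2 * g) * r^2
    = 3 * g * (2 * t + g * w)^2
      + 3 * (3 - g) * (t + g * w + (1 - g) * p + q + r)^2
      + (1 - g) * (3 * t + (2 * g - 1) * w + (2 - g) * q + 3 * r)^2"
  using assms by algebra

lemma psd_bordered_star:
  assumes "a > 0"
  shows "psd (bordered (x_star a) (X_star a))"
proof -
  have "v \<bullet> (bordered (x_star a) (X_star a) *v v) \<ge> 0" for v
  proof -
    \<comment> \<open>Rescaling the first coordinate removes \<open>a\<close> from the quadratic form.\<close>
    define w where "w = v $ Some 1 / a"
    have w: "v $ Some 1 = a * w"
      using assms by (simp add: w_def)
    define t p q r where "t = v $ None" and "p = v $ Some 2" and "q = v $ Some 3" and "r = v $ Some 4"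
    have "18 * (v \<bullet> (bordered (x_star a) (X_star a) *v v)) =
        18 * t^2 + 12 * t * (gam * w + p + 2 * q + (3 - 2 * gam) * r)
        + 3 * gam * w^2 + 12 * gam * w * p + 12 * gam * w * q + 12 * (1 - 3 * gam) * w * r
        + 6 * (1 - gam) * p^2 + 12 * p * q + 12 * p * r
        + 6 * (2 - gam) * q^2 + 24 * q * r + 6 * (3 - 2 * gam) * r^2"
      using assms
      unfolding quadratic_form_bordered x_star_def X_star_def t_def p_def q_def r_def
      apply (simp add: sum_4 w power2_eq_square)
      apply (simp add: field_simps)
      done
    also have "\<dots> \<ge> 0"
      unfolding three_points_identity[OF gam_squared] using gam_bounds by simp
    finally show ?thesis by simp
  qed
  then show ?thesis
    by (simp add: psd_def transpose_bordered transpose_X_star)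
qed

theorem proposition2:
  fixes a b :: real
  assumes "a \<in> {1/2..1}" and "b \<in> {1/2..1}"
  shows "sdp_optimal (Q_inst a b) (c_inst a b) (x_star a, X_star a) \<and>
    sdp_value (Q_inst a b) (c_inst a b) = ereal (sqrt 3 - 7/4) \<and>
    sqrt 3 - 7/4 < (0::real)"
proof -
  have "a > 0" and "b \<ge> 1/2"
    using assms by auto
  have val: "1/4 - gam = sqrt 3 - 7/4"
    by (simp add: gam_def)
  have "(x_star a, X_star a) \<in> sdp_feasible"
    using psd_bordered_star[OF \<open>a > 0\<close>] mccormick_star[OF assms(1)] transpose_X_star
    by (simp add: sdp_feasible_def)
  then have opt: "sdp_optimal (Q_inst a b) (c_inst a b) (x_star a, X_star a)"
    unfolding sdp_optimal_def
    using objective_lower_bound[OF \<open>a > 0\<close> \<open>b \<ge> 1/2\<close>] objective_star[OF \<open>a > 0\<close>] by auto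
  moreover have "sdp_value (Q_inst a b) (c_inst a b) = ereal (sqrt 3 - 7/4)"
    using sdp_value_eq_objective_of_optimal[OF opt] objective_star[OF \<open>a > 0\<close>] val by simp
  moreover have "sqrt 3 - 7/4 < (0::real)"
    using gam_bounds(1) val by linarith
  ultimately show ?thesis by blast
qed

end
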